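(* Let $p>0$ be a real number and let $\alpha$ be a cardinal number with $\alpha<\mathfrak{c}$. Then the set $\ell_p\setminus\bigcup_{0<q<p}\ell_q$ is $(\alpha,\mathfrak{c})$-spaceable in $\ell_p$ if and only if $\alpha<\aleph_0$.
   Context: All vector spaces are over a fixed scalar field $\mathbb{K}$, which is either $\mathbb{R}$ or $\mathbb{C}$; $\dim$ denotes the algebraic (Hamel) dimension, a cardinal number. $\mathfrak{c}=\mathrm{card}(\mathbb{R})$ and $\aleph_0=\mathrm{card}(\mathbb{N})$. For $p>0$, $\ell_p$ is the space of scalar sequences $(x_j)_{j=1}^\infty$ with $\|(x_j)\|_p=\left(\sum_{j=1}^\infty|x_j|^p\right)^{1/p}<\infty$; it is a Banach space if $p\ge 1$ and a $p$-Banach space if $0<p<1$. Closedness of subspaces of $\ell_p$ is with respect to the topology given by $\|\cdot\|_p$. Definitions. Let $V$ be a vector space. A set $A\subset V$ is $\alpha$-lineable if $A\cup\{0\}$ contains an $\alpha$-dimensional linear subspace of $V$. Let $V$ be a topological vector space and let $\alpha,\beta$ be cardinal numbers with $\alpha<\beta\le\dim V$. A set $A\subset V$ is $(\alpha,\beta)$-spaceable if it is $\alpha$-lineable and for every linear subspace $W_\alpha\subset V$ with $W_\alpha\subset A\cup\{0\}$ and $\dim W_\alpha=\alpha$ there is a closed linear subspace $W_\beta\subset V$ with $\dim W_\beta=\beta$ and $W_\alpha\subset W_\beta\subset A\cup\{0\}$. *)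

theory Defs
  imports "HOL-Analysis.Analysis" "HOL-Library.Function_Algebras"
begin

unbundle cardinal_syntax

section \<open>Hamel dimension, lineability and spaceability\<close>

text \<open>Cardinal numbers are cardinal orders (\<^const>\<open>Card_order\<close>), compared by \<open>=o\<close>, \<open><o\<close>, \<open>\<le>o\<close>.
  The library's \<open>dim\<close> is a natural number and is \<open>0\<close> for every infinite-dimensional space, so the
  Hamel dimension is defined here as a cardinal. The type \<^typ>\<open>'b\<close> only serves as a universe;
  the space under consideration is a subspace of it.\<close>

definition hamel_basis :: "('k::field \<Rightarrow> 'b \<Rightarrow> 'b) \<Rightarrow> 'b::ab_group_add set \<Rightarrow> 'b set \<Rightarrow> bool" where
  "hamel_basis scl W B \<longleftrightarrow> \<not> module.dependent scl B \<and> module.span scl B = W"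

definition hamel_dim :: "('k::field \<Rightarrow> 'b \<Rightarrow> 'b) \<Rightarrow> 'b::ab_group_add set \<Rightarrow> 'b rel" where
  "hamel_dim scl W = |SOME B. hamel_basis scl W B|"

context vector_space
begin

lemma hamel_basis_exists:
  assumes "subspace W"
  shows "\<exists>B. hamel_basis scale W B"
proof -
  obtain B where "B \<subseteq> W" "independent B" "W \<subseteq> span B"
    by (rule maximal_independent_subset)
  with assms show ?thesis
    unfolding hamel_basis_def by (metis span_minimal subset_antisym)
qed

lemma hamel_basis_card_le:
  assumes B: "hamel_basis scale W B" and C: "hamel_basis scale W C"
  shows "|B| \<le>o |C|"
proof (cases "finite C")
  case True
  then have "finite B \<and> card B \<le> card C"
    using assms independent_span_bound[of C B] span_superset[of B]
    by (simp add: hamel_basis_def)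
  then obtain f where "inj_on f B" "f ` B \<subseteq> C"
    using True card_le_inj by blast
  then show ?thesis
    by (auto intro!: card_of_ordLeqI[of f])
next
  case False
  have "\<exists>F. finite F \<and> F \<subseteq> B \<and> c \<in> span F" if "c \<in> C" for c
  proof -
    have "c \<in> span B"
      using that B C span_base by (auto simp: hamel_basis_def)
    then obtain t r where "finite t" "t \<subseteq> B" "c = (\<Sum>a\<in>t. r a *s a)"
      unfolding span_explicit by blast
    then show ?thesis
      by (intro exI[of _ t]) (auto intro!: span_sum intro: span_scale span_base)
  qed
  then obtain F where F: "\<And>c. c \<in> C \<Longrightarrow> finite (F c) \<and> F c \<subseteq> B \<and> c \<in> span (F c)"
    by metis
  have "C \<subseteq> span (\<Union>c\<in>C. F c)"
  proof
    fix c assume "c \<in> C"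
    then have "c \<in> span (F c)" "F c \<subseteq> (\<Union>c\<in>C. F c)"
      using F by blast+
    then show "c \<in> span (\<Union>c\<in>C. F c)"
      using span_mono by blast
  qed
  then have span: "span B \<subseteq> span (\<Union>c\<in>C. F c)"
    using B C span_minimal[OF _ subspace_span, of C] by (auto simp: hamel_basis_def)
  have "B \<subseteq> (\<Union>c\<in>C. F c)"
  proof (rule ccontr)
    assume "\<not> B \<subseteq> (\<Union>c\<in>C. F c)"
    then obtain b where b: "b \<in> B" "b \<notin> (\<Union>c\<in>C. F c)"
      by blast
    then have "(\<Union>c\<in>C. F c) \<subseteq> B - {b}"
      using F by blast
    then have "span (\<Union>c\<in>C. F c) \<subseteq> span (B - {b})"
      by (rule span_mono)
    moreover have "b \<in> span B"
      using b by (intro span_base)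
    ultimately have "b \<in> span (B - {b})"
      using span by blast
    then show False
      using B b by (auto simp: hamel_basis_def dependent_def)
  qed
  then have "|B| \<le>o |\<Union>c\<in>C. F c|"
    by (rule card_of_mono1)
  moreover have "|F c| \<le>o |C|" if "c \<in> C" for c
  proof -
    have "|F c| <o natLeq"
      using F[OF that] by (simp add: finite_iff_ordLess_natLeq)
    moreover have "natLeq \<le>o |C|"
      using False infinite_iff_natLeq_ordLeq by blast
    ultimately show ?thesis
      using ordLess_ordLeq_trans ordLess_imp_ordLeq by blast
  qed
  then have "|\<Union>c\<in>C. F c| \<le>o |C|"
    using False by (intro card_of_UNION_ordLeq_infinite ballI ordLeq_refl card_of_Card_order)
  ultimately show ?thesis
    by (rule ordLeq_transitive)
qed

lemma hamel_dim_eq: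
  assumes "hamel_basis scale W B"
  shows "hamel_dim scale W =o |B|"
proof -
  have "hamel_basis scale W (SOME B. hamel_basis scale W B)"
    using assms by (rule someI)
  then show ?thesis
    unfolding hamel_dim_def ordIso_iff_ordLeq
    using assms by (intro conjI hamel_basis_card_le)
qed

end

definition lineable :: "('k::field \<Rightarrow> 'b \<Rightarrow> 'b) \<Rightarrow> 'c rel \<Rightarrow> 'b::ab_group_add set \<Rightarrow> bool" where
  "lineable scl \<alpha> A \<longleftrightarrow> (\<exists>W. module.subspace scl W \<and> W \<subseteq> A \<union> {0} \<and> hamel_dim scl W =o \<alpha>)"

text \<open>The topological vector space is the carrier \<open>topspace T\<close> with the topology \<open>T\<close>.\<close>

definition spaceable ::
    "('k::field \<Rightarrow> 'b \<Rightarrow> 'b) \<Rightarrow> 'b topology \<Rightarrow> 'c rel \<Rightarrow> 'd rel \<Rightarrow> 'b::ab_group_add set \<Rightarrow> bool" where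
  "spaceable scl T \<alpha> \<beta> A \<longleftrightarrow>
     A \<subseteq> topspace T \<and> \<alpha> <o \<beta> \<and> \<beta> \<le>o hamel_dim scl (topspace T) \<and>
     lineable scl \<alpha> A \<and>
     (\<forall>W. module.subspace scl W \<and> W \<subseteq> A \<union> {0} \<and> hamel_dim scl W =o \<alpha> \<longrightarrow>
        (\<exists>W'. module.subspace scl W' \<and> closedin T W' \<and> hamel_dim scl W' =o \<beta> \<and>
              W \<subseteq> W' \<and> W' \<subseteq> A \<union> {0}))"

section \<open>The spaces \<open>\<ell>\<^sub>p\<close>\<close>

definition seq_scale :: "'k::field \<Rightarrow> (nat \<Rightarrow> 'k) \<Rightarrow> nat \<Rightarrow> 'k" where
  "seq_scale c x = (\<lambda>j. c * x j)"

global_interpretation seq: vector_space "seq_scale :: 'k::field \<Rightarrow> (nat \<Rightarrow> 'k) \<Rightarrow> nat \<Rightarrow> 'k"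
  by standard (auto simp: seq_scale_def fun_eq_iff algebra_simps)

definition lp :: "real \<Rightarrow> (nat \<Rightarrow> 'k::real_normed_field) set" where
  "lp p = {x. summable (\<lambda>j. norm (x j) powr p)}"

definition lp_norm :: "real \<Rightarrow> (nat \<Rightarrow> 'k::real_normed_field) \<Rightarrow> real" where
  "lp_norm p x = (\<Sum>j. norm (x j) powr p) powr (1 / p)"

text \<open>The topology of the (quasi-)norm, uniformly in \<open>p > 0\<close>. For \<open>p < 1\<close> its balls are those of
  the metric \<open>\<parallel>x - y\<parallel>\<^sub>p\<^sup>p\<close> with rescaled radii, so this is the usual topology of \<open>\<ell>\<^sub>p\<close>.\<close>

definition lp_topology :: "real \<Rightarrow> (nat \<Rightarrow> 'k::real_normed_field) topology" where
  "lp_topology p = topology (\<lambda>U. U \<subseteq> lp p \<and>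
     (\<forall>x\<in>U. \<exists>e>0. \<forall>y\<in>lp p. lp_norm p (y - x) < e \<longrightarrow> y \<in> U))"

lemma openin_lp_topology:
  fixes U :: "(nat \<Rightarrow> 'k::real_normed_field) set"
  shows "openin (lp_topology p) U \<longleftrightarrow>
     U \<subseteq> lp p \<and> (\<forall>x\<in>U. \<exists>e>0. \<forall>y\<in>lp p. lp_norm p (y - x) < e \<longrightarrow> y \<in> U)"
proof -
  define L where "L = (\<lambda>U :: (nat \<Rightarrow> 'k) set. U \<subseteq> lp p \<and>
     (\<forall>x\<in>U. \<exists>e>0. \<forall>y\<in>lp p. lp_norm p (y - x) < e \<longrightarrow> y \<in> U))"
  have "L (S \<inter> T)" if "L S" "L T" for S T
    unfolding L_def
  proof (intro conjI ballI)
    show "S \<inter> T \<subseteq> lp p"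
      using that by (auto simp: L_def)
    fix x assume "x \<in> S \<inter> T"
    then obtain d e where "d > 0" "e > 0"
      and "\<forall>y\<in>lp p. lp_norm p (y - x) < d \<longrightarrow> y \<in> S"
      and "\<forall>y\<in>lp p. lp_norm p (y - x) < e \<longrightarrow> y \<in> T"
      using \<open>L S\<close> \<open>L T\<close> unfolding L_def by blast
    then show "\<exists>e>0. \<forall>y\<in>lp p. lp_norm p (y - x) < e \<longrightarrow> y \<in> S \<inter> T"
      by (intro exI[of _ "min d e"]) auto
  qed
  moreover have "L (\<Union>\<K>)" if "\<forall>K\<in>\<K>. L K" for \<K>
    using that unfolding L_def by (meson Union_iff Union_least)
  ultimately have "istopology L"
    unfolding istopology_def by blast
  then have "openin (topology L) = L"
    by (rule topology_inverse')
  then show ?thesis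
    unfolding lp_topology_def L_def[symmetric] by (simp add: L_def)
qed

lemma topspace_lp_topology [simp]: "topspace (lp_topology p) = lp p"
proof
  show "topspace (lp_topology p) \<subseteq> lp p"
    using openin_lp_topology openin_topspace by blast
  have "openin (lp_topology p) (lp p)"
    unfolding openin_lp_topology by (auto intro: exI[of _ 1])
  then show "lp p \<subseteq> topspace (lp_topology p)"
    by (rule openin_subset)
qed

lemma subspace_lp:
  assumes "p > 0"
  shows "seq.subspace (lp p :: (nat \<Rightarrow> 'k::real_normed_field) set)"
  unfolding seq.subspace_def
proof (intro conjI ballI allI)
  show "(0 :: nat \<Rightarrow> 'k) \<in> lp p"
    by (simp add: lp_def)
next
  fix x y :: "nat \<Rightarrow> 'k" assume "x \<in> lp p" "y \<in> lp p"
  then have s: "summable (\<lambda>j. 2 powr p * (norm (x j) powr p + norm (y j) powr p))"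
    by (auto simp: lp_def intro!: summable_mult summable_add)
  have "norm (x j + y j) powr p \<le> 2 powr p * (norm (x j) powr p + norm (y j) powr p)" for j
  proof -
    have "norm (x j + y j) \<le> 2 * max (norm (x j)) (norm (y j))"
      using norm_triangle_ineq[of "x j" "y j"] by linarith
    then have "norm (x j + y j) powr p \<le> (2 * max (norm (x j)) (norm (y j))) powr p"
      using assms by (intro powr_mono2) auto
    also have "\<dots> = 2 powr p * max (norm (x j)) (norm (y j)) powr p"
      by (simp add: powr_mult)
    also have "max (norm (x j)) (norm (y j)) powr p \<le> norm (x j) powr p + norm (y j) powr p"
      by (simp add: max_def)
    finally show ?thesis
      by simp
  qed
  then show "x + y \<in> lp p"
    unfolding lp_def by (auto intro!: summable_comparison_test[OF _ s])
next
  fix c and x :: "nat \<Rightarrow> 'k" assume "x \<in> lp p"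
  then show "seq_scale c x \<in> lp p"
    by (auto simp: lp_def seq_scale_def norm_mult powr_mult intro: summable_mult)
qed

definition lp_strict :: "real \<Rightarrow> (nat \<Rightarrow> 'k::real_normed_field) set" where
  "lp_strict p = lp p - (\<Union>q\<in>{0<..<p}. lp q)"

end

theory Submission
  imports Defs "HOL-Computational_Algebra.Polynomial" "HOL-Real_Asymp.Real_Asymp"
begin

text \<open>Call a sequence strict if it lies in \<open>\<ell>\<^sub>p\<close> but in no \<open>\<ell>\<^sub>q\<close> with \<open>q < p\<close>.

  A finite basis of \<open>W\<close> tends to \<open>0\<close> coordinatewise, so along a sparse set \<open>M\<close> of positions every
  member of \<open>W\<close> decays geometrically; hence the nonzero members of \<open>W\<close> are outside every \<open>\<ell>\<^sub>q\<close> already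
  off \<open>M\<close>. Infinitely many disjoint copies of one strict sequence fit into \<open>M\<close>, and the sequences of
  \<open>\<ell>\<^sub>p\<close> that are a multiple of it on each copy form a closed subspace of dimension continuum whose sum
  with \<open>W\<close> is still strict. The sum is closed because it is again a common kernel of coordinate
  functionals.

  Conversely, if \<open>b\<close> runs through an infinite basis of a space of strict sequences and \<open>e\<close> is a unit
  vector, the vectors \<open>e + s\<^sub>b b\<close> with suitable scalars \<open>s\<^sub>b \<noteq> 0\<close> span a space of strict
  sequences whose closure contains \<open>e\<close>.\<close>

section \<open>Cardinality of sequence spaces\<close>

text \<open>Each scalar is coded by a set of naturals, through \<open>f\<close> and a bijection
  \<open>g\<close> from sets of naturals to reals. A sequence of such sets is one set of pairs,
  hence one set of naturals and again one real.\<close>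

lemma card_of_seqs_le_real:
  fixes f :: "'k \<Rightarrow> real"
  assumes "inj f"
  shows "|UNIV :: (nat \<Rightarrow> 'k) set| \<le>o |UNIV :: real set|"
proof -
  obtain g :: "nat set \<Rightarrow> real" where g: "bij g"
    using nat_sets_eqpoll_reals by (auto simp: eqpoll_def)
  define G where "G x = {n. snd (prod_decode n) \<in> inv g (f (x (fst (prod_decode n))))}"
    for x :: "nat \<Rightarrow> 'k"
  have "x = y" if "G x = G y" for x y
  proof
    fix n
    have "m \<in> inv g (f (x n)) \<longleftrightarrow> m \<in> inv g (f (y n))" for m
      using eqset_imp_iff[OF that, of "prod_encode (n, m)"] by (simp add: G_def)
    then have "inv g (f (x n)) = inv g (f (y n))"
      by blast
    then show "x n = y n"
      using bij_is_surj[OF g] assms by (metis injD surj_f_inv_f)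
  qed
  then have "inj (\<lambda>x. g (G x))"
    using bij_is_inj[OF g] by (auto simp: inj_def)
  then show ?thesis
    by (auto intro: card_of_ordLeqI)
qed

text \<open>The real and imaginary parts turn a complex number into a sequence of reals, and these
  inject into the reals.\<close>

lemma ex_inj_complex_real: "\<exists>f :: complex \<Rightarrow> real. inj f"
proof -
  have "inj (\<lambda>x. x :: real)"
    by simp
  then have "|UNIV :: (nat \<Rightarrow> real) set| \<le>o |UNIV :: real set|"
    by (rule card_of_seqs_le_real)
  then obtain g :: "(nat \<Rightarrow> real) \<Rightarrow> real" where g: "inj g"
    by (auto simp flip: card_of_ordLeq)
  define G where "G z = (\<lambda>n :: nat. if n = 0 then Re z else Im z)" for z
  have "z = w" if "G z = G w" for z w
    using fun_cong[OF that, of 0] fun_cong[OF that, of 1] by (simp add: G_def complex_eq_iff)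
  then have "inj G"
    by (rule injI)
  with g have "inj (g \<circ> G)"
    by (rule inj_compose)
  then show ?thesis
    by blast
qed

section \<open>Elements of the strict sequence space\<close>

text \<open>Cauchy condensation turns the series into one whose terms are of the order of
  \<open>1 / n^2\<close>.\<close>

lemma summable_bertrand_square: "summable (\<lambda>n. 1 / (real (Suc n) * (ln (real (Suc n)))\<^sup>2))"
proof -
  define f where "f = (\<lambda>n. 1 / (real (Suc n) * (ln (real (Suc n)))\<^sup>2))"
  \<comment> \<open>Monotonicity fails at \<open>m = 0\<close>: since \<open>ln 1 = 0\<close> and
    division by zero gives zero, \<open>f 0 = 0\<close>.\<close>
  have "f (Suc m) \<le> f m" if "0 < m" for m
    using that unfolding f_def
    by (intro divide_left_mono mult_mono power_mono) auto
  then have "summable f \<longleftrightarrow> summable (\<lambda>n. 2 ^ n * f (2 ^ n))"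
    by (rule condensation_test) (auto simp: f_def)
  moreover have "summable (\<lambda>n. 2 ^ n * f (2 ^ n))"
  proof (rule summable_comparison_test_bigo)
    show "summable (\<lambda>n. norm (real n powr (-2)))"
      using summable_real_powr_iff[of "-2"] by simp
    show "(\<lambda>n. 2 ^ n * f (2 ^ n)) \<in> O(\<lambda>n. real n powr (-2))"
      unfolding f_def of_nat_Suc of_nat_power of_nat_numeral by real_asymp
  qed
  ultimately show ?thesis
    by (simp add: f_def)
qed

text \<open>For \<open>r < 1\<close> the power of the logarithm is absorbed by
  \<open>n^(1 - r)\<close>, so the terms dominate the harmonic series.\<close>

lemma not_summable_bertrand_square_powr:
  assumes "0 < r" "r < 1"
  shows "\<not> summable (\<lambda>n. (1 / (real (Suc n) * (ln (real (Suc n)))\<^sup>2)) powr r)"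
proof
  assume "summable (\<lambda>n. (1 / (real (Suc n) * (ln (real (Suc n)))\<^sup>2)) powr r)"
  then have "summable (\<lambda>n. norm ((1 / (real (Suc n) * (ln (real (Suc n)))\<^sup>2)) powr r))"
    by simp
  moreover have "(\<lambda>n. real n powr (-1)) \<in> O(\<lambda>n. (1 / (real (Suc n) * (ln (real (Suc n)))\<^sup>2)) powr r)"
    using assms unfolding of_nat_Suc by real_asymp
  ultimately have "summable (\<lambda>n. real n powr (-1))"
    by (rule summable_comparison_test_bigo)
  then show False
    using summable_real_powr_iff[of "-1"] by simp
qed

lemma ex_pos_strict_seq:
  assumes "p > 0"
  obtains x :: "nat \<Rightarrow> real" where "\<And>j. x j > 0" "summable (\<lambda>j. x j powr p)"
    "\<And>q. 0 < q \<Longrightarrow> q < p \<Longrightarrow> \<not> summable (\<lambda>j. x j powr q)"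
proof
  define b where "b = (\<lambda>n. 1 / (real (Suc n) * (ln (real (Suc n)))\<^sup>2))"
  \<comment> \<open>The \<open>p\<close>-th powers of \<open>x\<close> are Bertrand terms, and the
    \<open>q\<close>-th powers are their powers with exponent \<open>q / p < 1\<close>. The shift
    skips \<open>b 0 = 0\<close>, which would spoil positivity.\<close>
  define x where "x = (\<lambda>j. b (Suc j) powr (1 / p))"
  have b: "b (Suc j) > 0" for j
    by (simp add: b_def)
  then show "x j > 0" for j
    unfolding x_def by (simp add: less_imp_neq[symmetric])
  have "x j powr p = b (Suc j)" for j
    using assms b[of j] by (simp add: x_def powr_powr)
  moreover have "summable (\<lambda>j. b (Suc j))"
    using summable_bertrand_square summable_Suc_iff[of b] by (simp add: b_def)
  ultimately show "summable (\<lambda>j. x j powr p)"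
    by simp
  fix q assume q: "0 < q" "q < p"
  have "x j powr q = b (Suc j) powr (q / p)" for j
    by (simp add: x_def powr_powr)
  moreover have "\<not> summable (\<lambda>j. b (Suc j) powr (q / p))"
    using not_summable_bertrand_square_powr[of "q / p"] q assms
      summable_Suc_iff[of "\<lambda>j. b j powr (q / p)"] by (simp add: b_def)
  ultimately show "\<not> summable (\<lambda>j. x j powr q)"
    by simp
qed

section \<open>Bounded functionals and closed subspaces\<close>

lemma lp_norm_nonneg: "lp_norm p z \<ge> 0"
  by (simp add: lp_norm_def)

lemma norm_le_lp_norm:
  fixes z :: "nat \<Rightarrow> 'k::real_normed_field"
  assumes "p > 0" "z \<in> lp p"
  shows "norm (z j) \<le> lp_norm p z"
proof -
  have "(\<Sum>i\<in>{j}. norm (z i) powr p) \<le> (\<Sum>i. norm (z i) powr p)"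
    using assms by (intro sum_le_suminf) (auto simp: lp_def)
  then have "(norm (z j) powr p) powr (1 / p) \<le> lp_norm p z"
    using assms unfolding lp_norm_def by (intro powr_mono2) auto
  then show ?thesis
    using assms by (simp add: powr_powr)
qed

lemma lp_norm_scale:
  assumes "p > 0" "z \<in> lp p"
  shows "lp_norm p (seq_scale c z) = norm c * lp_norm p z"
proof -
  have summable: "summable (\<lambda>j. norm (z j) powr p)"
    using assms by (simp add: lp_def)
  have "(\<Sum>j. norm (seq_scale c z j) powr p) = norm c powr p * (\<Sum>j. norm (z j) powr p)"
    using suminf_mult[OF summable] by (simp add: seq_scale_def norm_mult powr_mult)
  moreover have "(\<Sum>j. norm (z j) powr p) \<ge> 0"
    using summable by (intro suminf_nonneg) auto
  ultimately show ?thesis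
    using \<open>p > 0\<close> by (simp add: lp_norm_def powr_mult powr_powr)
qed

text \<open>The functionals are defined and linear on all sequences and bounded only on
  \<open>lp p\<close>. Kernels can therefore be computed among all sequences and intersected with
  \<open>lp p\<close> at the end.\<close>

definition lp_dual :: "real \<Rightarrow> ((nat \<Rightarrow> 'k::real_normed_field) \<Rightarrow> 'k) set" where
  "lp_dual p = {\<phi>. (\<forall>x y. \<phi> (x + y) = \<phi> x + \<phi> y) \<and> (\<forall>c x. \<phi> (seq_scale c x) = c * \<phi> x) \<and>
     (\<exists>C. \<forall>z\<in>lp p. norm (\<phi> z) \<le> C * lp_norm p z)}"

lemma lp_dual_add: "\<phi> \<in> lp_dual p \<Longrightarrow> \<phi> (x + y) = \<phi> x + \<phi> y"
  by (simp add: lp_dual_def)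

lemma lp_dual_scale: "\<phi> \<in> lp_dual p \<Longrightarrow> \<phi> (seq_scale c x) = c * \<phi> x"
  by (simp add: lp_dual_def)

lemma lp_dual_bound:
  assumes "\<phi> \<in> lp_dual p"
  obtains C where "\<And>z. z \<in> lp p \<Longrightarrow> norm (\<phi> z) \<le> C * lp_norm p z"
  using assms unfolding lp_dual_def by blast

lemma lp_dual_diff:
  assumes "\<phi> \<in> lp_dual p"
  shows "\<phi> (x - y) = \<phi> x - \<phi> y"
  using lp_dual_add[OF assms, of "x - y" y] by simp

lemma lp_dual_coord:
  assumes "p > 0"
  shows "(\<lambda>z. z j) \<in> lp_dual p"
  unfolding lp_dual_def using norm_le_lp_norm[OF assms]
  by (auto simp: seq_scale_def intro!: exI[of _ 1])

text \<open>A difference with two coefficients is the form shared by the proportionality relations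
  in \<open>copies\<close> and the elimination in \<open>common_kernel_add_vector\<close>.\<close>

lemma lp_dual_lincomb:
  assumes \<phi>: "\<phi> \<in> lp_dual p" and \<psi>: "\<psi> \<in> lp_dual p"
  shows "(\<lambda>z. a * \<phi> z - b * \<psi> z) \<in> lp_dual p"
proof -
  obtain C D where C: "\<And>z. z \<in> lp p \<Longrightarrow> norm (\<phi> z) \<le> C * lp_norm p z"
    and D: "\<And>z. z \<in> lp p \<Longrightarrow> norm (\<psi> z) \<le> D * lp_norm p z"
    using lp_dual_bound[OF \<phi>] lp_dual_bound[OF \<psi>] by metis
  have "norm (a * \<phi> z - b * \<psi> z) \<le> (norm a * C + norm b * D) * lp_norm p z" if "z \<in> lp p" for z
  proof -
    have "norm (a * \<phi> z - b * \<psi> z) \<le> norm a * norm (\<phi> z) + norm b * norm (\<psi> z)"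
      using norm_triangle_ineq4[of "a * \<phi> z" "b * \<psi> z"] by (simp add: norm_mult)
    also have "\<dots> \<le> norm a * (C * lp_norm p z) + norm b * (D * lp_norm p z)"
      using C[OF that] D[OF that] by (intro add_mono mult_left_mono) auto
    finally show ?thesis
      by (simp add: algebra_simps)
  qed
  then show ?thesis
    using lp_dual_add[OF \<phi>] lp_dual_add[OF \<psi>] lp_dual_scale[OF \<phi>] lp_dual_scale[OF \<psi>]
    unfolding lp_dual_def mem_Collect_eq
    by (intro conjI exI[of _ "norm a * C + norm b * D"]) (simp_all add: algebra_simps)
qed

definition common_kernel :: "('b \<Rightarrow> 'k::zero) set \<Rightarrow> 'b set" where
  "common_kernel \<Phi> = {z. \<forall>\<phi>\<in>\<Phi>. \<phi> z = 0}"

text \<open>A bounded functional that is nonzero at \<open>x\<close> stays nonzero on a ball around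
  \<open>x\<close>, so the complement is open.\<close>

lemma closedin_lp_kernels:
  fixes \<Phi> :: "((nat \<Rightarrow> 'k::real_normed_field) \<Rightarrow> 'k) set"
  assumes "p > 0" and \<Phi>: "\<Phi> \<subseteq> lp_dual p"
  shows "closedin (lp_topology p) (lp p \<inter> common_kernel \<Phi>)"
  unfolding closedin_def openin_lp_topology topspace_lp_topology
proof (intro conjI ballI)
  fix x assume "x \<in> lp p - lp p \<inter> common_kernel \<Phi>"
  then obtain \<phi> where x: "x \<in> lp p" "\<phi> \<in> \<Phi>" "\<phi> x \<noteq> 0"
    by (auto simp: common_kernel_def)
  with \<Phi> have \<phi>: "\<phi> \<in> lp_dual p"
    by blast
  then obtain C where C: "\<And>z. z \<in> lp p \<Longrightarrow> norm (\<phi> z) \<le> C * lp_norm p z"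
    using lp_dual_bound by blast
  \<comment> \<open>The bound \<open>C\<close> may be zero or negative;
    \<open>\<bar>C\<bar> + 1\<close> is a positive replacement by which one can divide.\<close>
  have "\<phi> y \<noteq> 0" if y: "y \<in> lp p" "lp_norm p (y - x) < norm (\<phi> x) / (\<bar>C\<bar> + 1)" for y
  proof
    assume "\<phi> y = 0"
    then have "norm (\<phi> x) = norm (\<phi> (y - x))"
      using lp_dual_diff[OF \<phi>] by simp
    also have "\<dots> \<le> C * lp_norm p (y - x)"
      using x y by (intro C seq.subspace_diff subspace_lp assms)
    also have "\<dots> \<le> (\<bar>C\<bar> + 1) * lp_norm p (y - x)"
      using lp_norm_nonneg[of p "y - x"] by (intro mult_right_mono) auto
    also have "\<dots> < norm (\<phi> x)"
      using y by (simp add: pos_less_divide_eq mult.commute add_nonneg_pos)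
    finally show False
      by simp
  qed
  moreover have "norm (\<phi> x) / (\<bar>C\<bar> + 1) > 0"
    using x by (intro divide_pos_pos) auto
  ultimately show "\<exists>e>0. \<forall>y\<in>lp p. lp_norm p (y - x) < e \<longrightarrow> y \<in> lp p - lp p \<inter> common_kernel \<Phi>"
    using x unfolding common_kernel_def by blast
qed auto

text \<open>A functional that does not vanish on \<open>b\<close> eliminates \<open>b\<close> from all the others.\<close>

lemma common_kernel_add_vector:
  fixes \<Phi> :: "((nat \<Rightarrow> 'k::real_normed_field) \<Rightarrow> 'k) set"
  assumes \<Phi>: "\<Phi> \<subseteq> lp_dual p"
  obtains \<Psi> where "\<Psi> \<subseteq> lp_dual p"
    "common_kernel \<Psi> = {z. \<exists>k. z - seq_scale k b \<in> common_kernel \<Phi>}"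
proof -
  have eq: "z - seq_scale k b \<in> common_kernel \<Phi> \<longleftrightarrow> (\<forall>\<phi>\<in>\<Phi>. \<phi> z = k * \<phi> b)" for z k
    unfolding common_kernel_def mem_Collect_eq
  proof (intro ball_cong refl)
    fix \<phi> assume "\<phi> \<in> \<Phi>"
    with \<Phi> have "\<phi> \<in> lp_dual p"
      by blast
    then show "\<phi> (z - seq_scale k b) = 0 \<longleftrightarrow> \<phi> z = k * \<phi> b"
      by (simp add: lp_dual_diff lp_dual_scale)
  qed
  show thesis
  proof (cases "\<forall>\<phi>\<in>\<Phi>. \<phi> b = 0")
    case True
    have "(\<forall>\<phi>\<in>\<Phi>. \<phi> z = k * \<phi> b) \<longleftrightarrow> (\<forall>\<phi>\<in>\<Phi>. \<phi> z = 0)" for z k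
    proof (intro ball_cong refl)
      fix \<phi> assume "\<phi> \<in> \<Phi>"
      with True have "\<phi> b = 0"
        by blast
      then show "\<phi> z = k * \<phi> b \<longleftrightarrow> \<phi> z = 0"
        by simp
    qed
    then have "common_kernel \<Phi> = {z. \<exists>k. z - seq_scale k b \<in> common_kernel \<Phi>}"
      unfolding eq by (simp add: common_kernel_def)
    then show thesis
      by (rule that[OF \<Phi>])
  next
    case False
    then obtain \<theta> where \<theta>: "\<theta> \<in> \<Phi>" "\<theta> b \<noteq> 0"
      by blast
    \<comment> \<open>Subtracting a multiple of \<open>\<theta>\<close> makes each functional vanish
      at \<open>b\<close>. On the new kernel \<open>\<theta>\<close> itself dictates the coefficient
      \<open>k = \<theta> z / \<theta> b\<close>. The factor \<open>1\<close> fits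
      \<open>lp_dual_lincomb\<close>.\<close>
    define \<Psi> where "\<Psi> = (\<lambda>\<phi> z. 1 * \<phi> z - (\<phi> b / \<theta> b) * \<theta> z) ` \<Phi>"
    have "\<Psi> \<subseteq> lp_dual p"
      unfolding \<Psi>_def
    proof (rule image_subsetI)
      fix \<phi> assume "\<phi> \<in> \<Phi>"
      with \<Phi> \<theta> show "(\<lambda>z. 1 * \<phi> z - (\<phi> b / \<theta> b) * \<theta> z) \<in> lp_dual p"
        by (intro lp_dual_lincomb) auto
    qed
    moreover have "z \<in> common_kernel \<Psi> \<longleftrightarrow> (\<exists>k. z - seq_scale k b \<in> common_kernel \<Phi>)" for z
    proof
      assume "z \<in> common_kernel \<Psi>"
      then have "\<phi> z = (\<theta> z / \<theta> b) * \<phi> b" if "\<phi> \<in> \<Phi>" for \<phi>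
        using that \<theta> by (auto simp: \<Psi>_def common_kernel_def mult.commute)
      then show "\<exists>k. z - seq_scale k b \<in> common_kernel \<Phi>"
        unfolding eq by blast
    next
      assume "\<exists>k. z - seq_scale k b \<in> common_kernel \<Phi>"
      then obtain k where k: "\<phi> z = k * \<phi> b" if "\<phi> \<in> \<Phi>" for \<phi>
        unfolding eq by blast
      have "1 * \<phi> z - (\<phi> b / \<theta> b) * \<theta> z = 0" if "\<phi> \<in> \<Phi>" for \<phi>
        using \<theta> k[OF that] k[OF \<theta>(1)] by simp
      then show "z \<in> common_kernel \<Psi>"
        by (simp add: \<Psi>_def common_kernel_def)
    qed
    ultimately show thesis
      by (intro that[of \<Psi>]) auto
  qed
qed

text \<open>Adding the basis vectors one at a time shows that a kernel plus a finite-dimensional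
  space is again a kernel. Its intersection with \<open>lp p\<close> is then closed without any
  limit argument.\<close>

lemma common_kernel_add_span:
  fixes \<Phi> :: "((nat \<Rightarrow> 'k::real_normed_field) \<Rightarrow> 'k) set"
  assumes "finite B" and \<Phi>: "\<Phi> \<subseteq> lp_dual p"
  shows "\<exists>\<Psi>\<subseteq>lp_dual p. common_kernel \<Psi> = {z. \<exists>w\<in>seq.span B. z - w \<in> common_kernel \<Phi>}"
  using assms(1)
proof induction
  case empty
  then show ?case
    using \<Phi> by (intro exI[of _ \<Phi>]) auto
next
  case (insert b B)
  then obtain \<Psi> where \<Psi>: "\<Psi> \<subseteq> lp_dual p"
    "common_kernel \<Psi> = {z. \<exists>w\<in>seq.span B. z - w \<in> common_kernel \<Phi>}"
    by blast
  have eq: "{z. \<exists>k. z - seq_scale k b \<in> common_kernel \<Psi>} =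
      {z. \<exists>w\<in>seq.span (insert b B). z - w \<in> common_kernel \<Phi>}" (is "?L = ?R")
  proof (intro subset_antisym subsetI)
    fix z assume "z \<in> ?L"
    then obtain k w where "w \<in> seq.span B" "z - seq_scale k b - w \<in> common_kernel \<Phi>"
      unfolding \<Psi> by blast
    moreover from this have "seq_scale k b + w \<in> seq.span (insert b B)"
      unfolding seq.span_breakdown_eq by (intro exI[of _ k]) simp
    ultimately show "z \<in> ?R"
      unfolding diff_diff_add by blast
  next
    fix z assume "z \<in> ?R"
    then obtain k w where w: "w - seq_scale k b \<in> seq.span B" "z - w \<in> common_kernel \<Phi>"
      by (auto simp: seq.span_breakdown_eq)
    have "z - w = z - seq_scale k b - (w - seq_scale k b)"
      by simp
    with w show "z \<in> ?L"
      unfolding \<Psi> by (metis (mono_tags, lifting) mem_Collect_eq)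
  qed
  obtain \<Psi>' where "\<Psi>' \<subseteq> lp_dual p"
    "common_kernel \<Psi>' = {z. \<exists>k. z - seq_scale k b \<in> common_kernel \<Psi>}"
    using common_kernel_add_vector[OF \<Psi>(1)] .
  then show ?case
    unfolding eq by (intro exI[of _ \<Psi>'] conjI)
qed

section \<open>The extension of finite-dimensional subspaces\<close>

text \<open>Members of \<open>lp p\<close> tend to zero, and finitely many of them are small
  simultaneously from some position on; the positions are then chosen recursively.\<close>

lemma ex_sparse_subsequence:
  fixes B :: "(nat \<Rightarrow> 'k::real_normed_field) set"
  assumes "p > 0" "finite B" "B \<subseteq> lp p"
  obtains h :: "nat \<Rightarrow> nat" where "strict_mono h" "\<And>b n. b \<in> B \<Longrightarrow> norm (b (h n)) \<le> (1 / 2) ^ n"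
proof -
  have "\<forall>\<^sub>F j in sequentially. norm (b j) < e" if "b \<in> B" "e > 0" for b e
  proof -
    have "(\<lambda>j. norm (b j) powr p) \<longlonglongrightarrow> 0"
      using assms that by (intro summable_LIMSEQ_zero) (auto simp: lp_def)
    then have "\<forall>\<^sub>F j in sequentially. norm (b j) powr p < e powr p"
      by (rule order_tendstoD) (use that in simp)
    then show ?thesis
    proof eventually_elim
      case (elim j)
      then show ?case
        using assms that powr_mono2[of p e "norm (b j)"] by (cases "norm (b j) < e") auto
    qed
  qed
  then have ev: "\<forall>\<^sub>F j in sequentially. \<forall>b\<in>B. norm (b j) < e" if "e > 0" for e
    using that assms by (intro eventually_ball_finite) auto
  have large: "\<exists>j>i. \<forall>b\<in>B. norm (b j) < (1 / 2) ^ n" for i n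
  proof -
    have "\<forall>\<^sub>F j in sequentially. (\<forall>b\<in>B. norm (b j) < (1 / 2) ^ n) \<and> j > i"
      by (intro eventually_conj ev eventually_gt_at_top) simp
    then show ?thesis
      using eventually_happens by fastforce
  qed
  have "\<exists>h. \<forall>n. (\<forall>b\<in>B. norm (b (h n)) < (1 / 2) ^ n) \<and> h n < h (Suc n)"
    using large by (intro dependent_nat_choice) metis+
  then obtain h where "\<forall>n. (\<forall>b\<in>B. norm (b (h n)) < (1 / 2) ^ n) \<and> h n < h (Suc n)"
    by blast
  then show thesis
    by (intro that[of h]) (auto simp: strict_mono_Suc_iff less_imp_le)
qed

text \<open>The sequences whose restriction along \<open>h\<close> lies in \<open>lp q\<close> form
  a subspace, which contains \<open>B\<close> by comparison with a geometric series of ratio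
  \<open>(1 / 2) powr q\<close>. One \<open>h\<close> serves all \<open>q > 0\<close>.\<close>

lemma span_comp_lp_of_geometric:
  fixes B :: "(nat \<Rightarrow> 'k::real_normed_field) set"
  assumes B: "\<And>b n. b \<in> B \<Longrightarrow> norm (b (h n)) \<le> (1 / 2) ^ n" and w: "w \<in> seq.span B" and "q > 0"
  shows "w \<circ> h \<in> lp q"
proof -
  have "seq.subspace {w :: nat \<Rightarrow> 'k. w \<circ> h \<in> lp q}"
    using subspace_lp[OF \<open>q > 0\<close>, where 'k = 'k]
    unfolding seq.subspace_def by (auto simp: comp_def seq_scale_def plus_fun_def zero_fun_def)
  moreover have "B \<subseteq> {w. w \<circ> h \<in> lp q}"
  proof
    fix b assume b: "b \<in> B"
    have "norm (norm (b (h n)) powr q) \<le> ((1 / 2) powr q) ^ n" for n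
    proof -
      have "norm (b (h n)) powr q \<le> ((1 / 2) ^ n) powr q"
        using B[OF b] \<open>q > 0\<close> by (intro powr_mono2) auto
      also have "\<dots> = ((1 / 2) powr q) ^ n"
        by (simp add: powr_powr powr_realpow[symmetric] mult.commute)
      finally show ?thesis
        by simp
    qed
    moreover have "summable (\<lambda>n. ((1 / 2 :: real) powr q) ^ n)"
      using powr_less_mono2[of q "1 / 2" 1] \<open>q > 0\<close> by (intro summable_geometric) simp
    ultimately have "summable (\<lambda>n. norm (b (h n)) powr q)"
      by - (rule summable_comparison_test'[of _ 0], assumption, blast)
    then show "b \<in> {w. w \<circ> h \<in> lp q}"
      by (simp add: lp_def)
  qed
  ultimately show ?thesis
    using seq.span_minimal w by blast
qed

lemma lp_comp_inj:
  assumes "z \<in> lp q" "inj h"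
  shows "z \<circ> h \<in> lp q"
  using assms summable_reindex[of "\<lambda>j. norm (z j) powr q" h] by (simp add: lp_def comp_def)

text \<open>On the range of \<open>h\<close> the terms of \<open>w\<close> are summable by
  assumption, elsewhere they are those of \<open>z\<close>. Used in contrapositive form: changing
  \<open>w\<close> on a set where it is small cannot bring it into \<open>lp q\<close>.\<close>

lemma lp_if_eq_off_subsequence:
  fixes w z :: "nat \<Rightarrow> 'k::real_normed_field"
  assumes h: "strict_mono h" and w: "w \<circ> h \<in> lp q" and z: "z \<in> lp q"
    and eq: "\<And>j. j \<notin> range h \<Longrightarrow> w j = z j"
  shows "w \<in> lp q"
proof -
  define F where "F j = (if j \<in> range h then norm (w j) powr q else 0)" for j
  have "summable (\<lambda>n. F (h n))"
    using w by (simp add: F_def lp_def)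
  then have "summable F"
    using summable_mono_reindex[OF h, of F] by (simp add: F_def)
  then have "summable (\<lambda>j. F j + norm (z j) powr q)"
    using z by (intro summable_add) (simp_all add: lp_def)
  moreover have "norm (norm (w j) powr q) \<le> F j + norm (z j) powr q" for j
    using eq[of j] by (auto simp: F_def)
  ultimately have "summable (\<lambda>j. norm (w j) powr q)"
    by - (rule summable_comparison_test'[of _ 0], assumption, blast)
  then show ?thesis
    by (simp add: lp_def)
qed

text \<open>Nonnegative terms may be summed in any order, so the product of the two series can be
  enumerated by \<open>prod_decode\<close>.\<close>

lemma summable_product_decode:
  fixes f g :: "nat \<Rightarrow> real"
  assumes "summable f" "summable g" "\<And>n. f n \<ge> 0" "\<And>n. g n \<ge> 0"
  shows "summable (\<lambda>n. f (fst (prod_decode n)) * g (snd (prod_decode n)))"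
proof -
  have "(\<lambda>(k, i). f k * g i) summable_on (UNIV \<times> UNIV)"
  proof (rule summable_on_SigmaI)
    show "((\<lambda>i. case (k, i) of (k, i) \<Rightarrow> f k * g i) has_sum (f k * suminf g)) UNIV" for k
      using assms by (auto intro!: norm_summable_imp_has_sum summable_mult sums_mult summable_sums)
    show "(\<lambda>k. f k * suminf g) summable_on UNIV"
      using assms by (intro norm_summable_imp_summable_on) (simp add: abs_mult summable_mult2)
  qed (use assms in auto)
  then have "(\<lambda>n. case prod_decode n of (k, i) \<Rightarrow> f k * g i) summable_on UNIV"
    using summable_on_reindex_bij_betw[OF bij_prod_decode, of "\<lambda>(k, i). f k * g i"] by simp
  then show ?thesis
    using summable_on_imp_summable by (simp add: case_prod_beta)
qed

text \<open>This is the invertibility of the Vandermonde matrix. By linearity the weighted sum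
  vanishes for every polynomial evaluated at the nodes; the unnormalised Lagrange polynomial
  \<open>P\<close> isolates the node of \<open>s\<close>.\<close>

lemma coeffs_zero_if_power_sums_zero:
  fixes \<tau> :: "'a \<Rightarrow> 'k::idom"
  assumes "finite S" "inj_on \<tau> S" and sums: "\<And>k. (\<Sum>s\<in>S. a s * \<tau> s ^ k) = 0" and "s \<in> S"
  shows "a s = 0"
proof -
  define P where "P = (\<Prod>t\<in>S - {s}. [:- \<tau> t, 1:])"
  have P: "poly P x = (\<Prod>t\<in>S - {s}. x - \<tau> t)" for x
    by (simp add: P_def poly_prod)
  have zero: "poly P (\<tau> t) = 0" if "t \<in> S - {s}" for t
    using that \<open>finite S\<close> unfolding P by (intro prod_zero) auto
  have "(\<Sum>t\<in>S. a t * poly P (\<tau> t)) = (\<Sum>t\<in>S. \<Sum>k\<le>degree P. coeff P k * (a t * \<tau> t ^ k))"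
    by (simp add: poly_altdef sum_distrib_left algebra_simps)
  also have "\<dots> = (\<Sum>k\<le>degree P. coeff P k * (\<Sum>t\<in>S. a t * \<tau> t ^ k))"
    by (subst sum.swap) (simp add: sum_distrib_left)
  also have "\<dots> = 0"
    by (simp add: sums)
  finally have "(\<Sum>t\<in>S. a t * poly P (\<tau> t)) = 0" .
  moreover have "(\<Sum>t\<in>S. a t * poly P (\<tau> t)) = a s * poly P (\<tau> s)"
    using \<open>finite S\<close> \<open>s \<in> S\<close> zero by (subst sum.remove[of _ s]) (auto intro!: sum.neutral)
  moreover have "poly P (\<tau> s) \<noteq> 0"
    using \<open>inj_on \<tau> S\<close> \<open>s \<in> S\<close> \<open>finite S\<close> unfolding P by (auto simp: inj_on_def)
  ultimately show ?thesis
    by simp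
qed

lemma subspace_common_kernel:
  assumes "\<Phi> \<subseteq> lp_dual p"
  shows "seq.subspace (common_kernel \<Phi>)"
  unfolding seq.subspace_def common_kernel_def mem_Collect_eq
proof (intro conjI ballI allI impI)
  fix \<phi> assume "\<phi> \<in> \<Phi>"
  with assms have \<phi>: "\<phi> \<in> lp_dual p"
    by blast
  show "\<phi> 0 = 0"
    using lp_dual_diff[OF \<phi>, of 0 0] by simp
  fix y assume "y \<in> {z. \<forall>\<phi>\<in>\<Phi>. \<phi> z = 0}"
  with \<open>\<phi> \<in> \<Phi>\<close> have y: "\<phi> y = 0"
    by blast
  then show "\<phi> (seq_scale c y) = 0" for c
    using lp_dual_scale[OF \<phi>] by simp
  fix z assume "z \<in> {z. \<forall>\<phi>\<in>\<Phi>. \<phi> z = 0}"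
  with \<open>\<phi> \<in> \<Phi>\<close> have "\<phi> z = 0"
    by blast
  with y show "\<phi> (y + z) = 0"
    using lp_dual_add[OF \<phi>] by simp
qed

text \<open>\<open>h (prod_encode (k, i))\<close> is the \<open>i\<close>-th position of the \<open>k\<close>-th of infinitely many disjoint copies of
  \<open>x\<close> placed along \<open>h\<close>.\<close>

definition copies :: "(nat \<Rightarrow> nat) \<Rightarrow> (nat \<Rightarrow> real) \<Rightarrow> (nat \<Rightarrow> 'k::real_normed_field) set" where
  "copies h x = {v. (\<forall>j. j \<notin> range h \<longrightarrow> v j = 0) \<and>
     (\<forall>k i. v (h (prod_encode (k, i))) * of_real (x 0) = v (h (prod_encode (k, 0))) * of_real (x i))}"

text \<open>Each condition in \<open>copies\<close> is a homogeneous linear equation in at most two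
  coordinates.\<close>

lemma copies_common_kernel:
  assumes "p > 0"
  obtains \<Phi> :: "((nat \<Rightarrow> 'k::real_normed_field) \<Rightarrow> 'k) set"
  where "\<Phi> \<subseteq> lp_dual p" "common_kernel \<Phi> = copies h x"
proof
  let ?f = "\<lambda>k i (v :: nat \<Rightarrow> 'k).
    of_real (x 0) * v (h (prod_encode (k, i))) - of_real (x i) * v (h (prod_encode (k, 0)))"
  let ?\<Phi> = "(\<lambda>j v. v j) ` (- range h) \<union> (\<Union>k i. {?f k i})"
  have "?f k i \<in> lp_dual p" for k i
    by (intro lp_dual_lincomb lp_dual_coord assms)
  then show "?\<Phi> \<subseteq> lp_dual p"
    using lp_dual_coord[OF assms] by auto
  show "common_kernel ?\<Phi> = copies h x"
    by (simp add: common_kernel_def copies_def ball_Un mult.commute set_eq_iff) blast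
qed

text \<open>A nonzero entry lies in some copy \<open>k\<close>. There \<open>v\<close> is a nonzero
  multiple of \<open>x\<close>, so already its restriction to that copy is outside
  \<open>lp q\<close>.\<close>

lemma copies_notin_lp:
  fixes v :: "nat \<Rightarrow> 'k::real_normed_field"
  assumes h: "strict_mono h" and x: "x 0 > 0" "\<And>i. x i \<ge> 0" "\<not> summable (\<lambda>i. x i powr q)"
    and v: "v \<in> copies h x" "v \<noteq> 0"
  shows "v \<notin> lp q"
proof
  assume "v \<in> lp q"
  obtain j where j: "v j \<noteq> 0"
    using v(2) by (auto simp: fun_eq_iff)
  then have "j \<in> range h"
    using v(1) unfolding copies_def by blast
  then obtain n where n: "j = h n"
    by blast
  obtain k i where "n = prod_encode (k, i)"
    by (metis prod_decode_inverse surj_pair)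
  with j n have ki: "v (h (prod_encode (k, i))) \<noteq> 0"
    by simp
  have eq: "v (h (prod_encode (k, i))) * of_real (x 0) = v (h (prod_encode (k, 0))) * of_real (x i)" for i
    using v(1) by (simp add: copies_def)
  \<comment> \<open>The absolute value of the factor by which \<open>v\<close> multiplies
    \<open>x\<close> on the \<open>k\<close>-th copy.\<close>
  define c where "c = norm (v (h (prod_encode (k, 0)))) / x 0"
  have norm: "norm (v (h (prod_encode (k, i)))) = c * x i" for i
    using arg_cong[OF eq[of i], of norm] x by (simp add: norm_mult c_def field_simps)
  have "c \<noteq> 0"
    using ki norm[of i] by auto
  then have "c > 0"
    using x by (simp add: c_def)
  have "inj (\<lambda>i. h (prod_encode (k, i)))"
    using strict_mono_eq[OF h] by (simp add: inj_def)
  then have "(\<lambda>i. v (h (prod_encode (k, i)))) \<in> lp q"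
    using lp_comp_inj[OF \<open>v \<in> lp q\<close>] by (simp add: comp_def)
  then have "summable (\<lambda>i. c powr q * x i powr q)"
    using \<open>c > 0\<close> x by (simp add: lp_def norm powr_mult)
  then show False
    using x(3) \<open>c > 0\<close> by (simp add: summable_cmult_iff)
qed

text \<open>For each \<open>t\<close> between 0 and 1 the vector \<open>v t\<close> carries
  \<open>t ^ k\<close> times \<open>x\<close> on the \<open>k\<close>-th copy. Its
  \<open>p\<close>-th power sum factors into a geometric series and that of \<open>x\<close>, and
  different \<open>t\<close> give independent vectors by the Vandermonde argument.\<close>

lemma copies_large_independent:
  assumes h: "strict_mono h" and "p > 0" and x: "x 0 > 0" "\<And>i. x i \<ge> 0" "summable (\<lambda>i. x i powr p)"
  obtains T :: "(nat \<Rightarrow> 'k::real_normed_field) set"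
  where "T \<subseteq> lp p \<inter> copies h x" "\<not> seq.dependent T" "|UNIV :: real set| \<le>o |T|"
proof -
  define v :: "real \<Rightarrow> nat \<Rightarrow> 'k" where "v t j = (if j \<in> range h then
      (case prod_decode (inv h j) of (k, i) \<Rightarrow> of_real (t ^ k * x i)) else 0)" for t j
  have v_h: "v t (h (prod_encode (k, i))) = of_real (t ^ k * x i)" for t k i
    using strict_mono_imp_inj_on[OF h] by (simp add: v_def)
  have v_off: "v t j = 0" if "j \<notin> range h" for t j
    using that by (simp add: v_def)
  have copies: "v t \<in> copies h x" for t
    by (simp add: copies_def v_h v_off)
  have lp: "v t \<in> lp p" if t: "0 < t" "t < 1" for t
  proof -
    have "t powr p < 1"
      using powr_less_mono2[of p t 1] \<open>p > 0\<close> t by simp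
    then have "summable (\<lambda>n. (t powr p) ^ fst (prod_decode n) * x (snd (prod_decode n)) powr p)"
      using x by (intro summable_product_decode) auto
    moreover have "norm (v t (h n)) powr p =
        (t powr p) ^ fst (prod_decode n) * x (snd (prod_decode n)) powr p" for n
    proof -
      obtain k i where n: "n = prod_encode (k, i)"
        by (metis prod_decode_inverse surj_pair)
      have "norm (v t (h n)) powr p = (t ^ k * x i) powr p"
        using t x(2)[of i] unfolding n v_h norm_of_real by simp
      also have "\<dots> = (t ^ k) powr p * x i powr p"
        using t x by (simp add: powr_mult)
      also have "(t ^ k) powr p = (t powr p) ^ k"
        using t by (simp add: powr_powr powr_realpow[symmetric] mult.commute)
      finally show ?thesis
        by (simp add: n)
    qed
    ultimately have "summable (\<lambda>n. norm (v t (h n)) powr p)"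
      by simp
    then show ?thesis
      using summable_mono_reindex[OF h, of "\<lambda>j. norm (v t j) powr p"] v_off by (simp add: lp_def)
  qed
  define T where "T = v ` {0<..<1}"
  \<comment> \<open>Recovers the parameter \<open>t\<close> from \<open>v t\<close>, by reading the
    first entry of copy 1.\<close>
  define \<tau> :: "(nat \<Rightarrow> 'k) \<Rightarrow> 'k"
    where "\<tau> s = s (h (prod_encode (1, 0))) / of_real (x 0)" for s
  have \<tau>_v: "\<tau> (v t) = of_real t" for t
    using x(1) by (simp add: \<tau>_def v_h)
  then have "inj_on \<tau> T"
    by (auto simp: T_def inj_on_def)
  have "\<not> seq.dependent T"
    unfolding seq.independent_explicit_finite_subsets
  proof (intro allI impI ballI)
    fix S u s assume S: "S \<subseteq> T" "finite S" "(\<Sum>s\<in>S. seq_scale (u s) s) = 0" "s \<in> S"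
    \<comment> \<open>The first entry of the \<open>k\<close>-th copy turns the linear relation into
      the \<open>k\<close>-th power sum, up to the factor \<open>x 0\<close>.\<close>
    have "(\<Sum>s\<in>S. u s * \<tau> s ^ k) = 0" for k
    proof -
      have "0 = (\<Sum>s\<in>S. seq_scale (u s) s) (h (prod_encode (k, 0)))"
        using S by simp
      also have "\<dots> = (\<Sum>s\<in>S. u s * s (h (prod_encode (k, 0))))"
        using \<open>finite S\<close> by induction (auto simp: seq_scale_def)
      also have "\<dots> = (\<Sum>s\<in>S. (u s * \<tau> s ^ k) * of_real (x 0))"
        using S(1) by (intro sum.cong) (auto simp: T_def v_h \<tau>_v)
      finally show ?thesis
        using x(1) by (simp flip: sum_distrib_right)
    qed
    moreover have "inj_on \<tau> S"
      using \<open>inj_on \<tau> T\<close> S inj_on_subset by blast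
    ultimately show "u s = 0"
      using coeffs_zero_if_power_sums_zero[of S \<tau> u s] S by blast
  qed
  moreover have "|UNIV :: real set| \<le>o |T|"
  proof -
    have "inj v"
      using \<tau>_v by (metis injI of_real_eq_iff)
    then have "|{0<..<1 :: real}| =o |T|"
      unfolding T_def by (intro card_of_ordIsoI[of v] inj_on_imp_bij_betw) (rule inj_on_subset, auto)
    moreover have "|UNIV :: real set| =o |{0<..<1 :: real}|"
      using open_interval_eqpoll_reals[of 0 1] by (simp add: eqpoll_iff_card_of_ordIso ordIso_symmetric)
    ultimately show ?thesis
      using ordIso_transitive ordIso_imp_ordLeq by blast
  qed
  ultimately show thesis
    using copies lp by (intro that[of T]) (auto simp: T_def)
qed

text \<open>The independent set \<open>T\<close> records the lower bound for the dimension of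
  \<open>W'\<close>; the upper bound depends on the size of the scalar field and comes
  later.\<close>

lemma finite_dim_extension:
  fixes W :: "(nat \<Rightarrow> 'k::real_normed_field) set"
  assumes "p > 0" and B: "finite B" "seq.span B = W" and W: "W \<subseteq> lp_strict p \<union> {0}"
  obtains W' T where "seq.subspace W'" "closedin (lp_topology p) W'" "W \<subseteq> W'"
    "W' \<subseteq> lp_strict p \<union> {0}" "T \<subseteq> W'" "\<not> seq.dependent T" "|UNIV :: real set| \<le>o |T|"
proof -
  have "0 \<in> (lp p :: (nat \<Rightarrow> 'k) set)"
    using subspace_lp[OF \<open>p > 0\<close>] by (rule seq.subspace_0)
  then have W_lp: "W \<subseteq> lp p"
    using W by (auto simp: lp_strict_def)
  then have B_lp: "B \<subseteq> lp p"
    using B seq.span_superset by blast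
  obtain h where h: "strict_mono h" "\<And>b n. b \<in> B \<Longrightarrow> norm (b (h n)) \<le> (1 / 2) ^ n"
    using ex_sparse_subsequence[OF \<open>p > 0\<close> B(1) B_lp] by blast
  obtain x :: "nat \<Rightarrow> real" where x: "\<And>j. x j > 0" "summable (\<lambda>j. x j powr p)"
    "\<And>q. 0 < q \<Longrightarrow> q < p \<Longrightarrow> \<not> summable (\<lambda>j. x j powr q)"
    using ex_pos_strict_seq[OF \<open>p > 0\<close>] by blast
  obtain \<Phi> :: "((nat \<Rightarrow> 'k) \<Rightarrow> 'k) set"
    where \<Phi>: "\<Phi> \<subseteq> lp_dual p" "common_kernel \<Phi> = copies h x"
    using copies_common_kernel[OF \<open>p > 0\<close>] by blast
  obtain \<Psi> where \<Psi>: "\<Psi> \<subseteq> lp_dual p"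
    "common_kernel \<Psi> = {z. \<exists>w\<in>W. z - w \<in> copies h x}"
    using common_kernel_add_span[OF B(1) \<Phi>(1)] unfolding \<Phi>(2) B(2) by blast
  \<comment> \<open>As \<open>W\<close> lies in \<open>lp p\<close>, this is \<open>W\<close> plus
    the members of \<open>copies h x\<close> in \<open>lp p\<close>.\<close>
  define W' where "W' = lp p \<inter> common_kernel \<Psi>"
  have zero: "0 \<in> W"
    using B seq.span_zero by blast
  have copies0: "0 \<in> copies h x"
    by (simp add: copies_def)
  obtain T where T: "T \<subseteq> lp p \<inter> (copies h x :: (nat \<Rightarrow> 'k) set)" "\<not> seq.dependent T"
    "|UNIV :: real set| \<le>o |T|"
    using copies_large_independent[OF h(1) \<open>p > 0\<close>, of x] x by (metis less_imp_le)
  have "z \<in> lp_strict p \<union> {0}" if "z \<in> W'" for z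
  proof (cases "z = 0")
    case False
    obtain w where w: "w \<in> W" "z - w \<in> copies h x" and z: "z \<in> lp p"
      using \<open>z \<in> W'\<close> unfolding W'_def \<Psi>(2) by blast
    \<comment> \<open>If \<open>w = 0\<close>, then \<open>z\<close> is itself a nonzero member of
      \<open>copies h x\<close>. Otherwise \<open>z\<close> agrees with the strict sequence
      \<open>w\<close> off the range of \<open>h\<close>, where \<open>w\<close> is already too
      large for \<open>lp q\<close>.\<close>
    have "z \<notin> lp q" if q: "0 < q" "q < p" for q
    proof (cases "w = 0")
      case True
      then show ?thesis
        using w False x q h by (intro copies_notin_lp[of h x q]) (auto intro: less_imp_le)
    next
      case nz: False
      show ?thesis
      proof
        assume "z \<in> lp q"
        moreover have "w j = z j" if "j \<notin> range h" for j
          using w that by (auto simp: copies_def)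
        moreover have "w \<circ> h \<in> lp q"
          using span_comp_lp_of_geometric[of B h w q] h B w q by blast
        ultimately have "w \<in> lp q"
          using lp_if_eq_off_subsequence[OF h(1)] by blast
        then show False
          using w nz W q by (auto simp: lp_strict_def)
      qed
    qed
    then show ?thesis
      using z by (auto simp: lp_strict_def)
  qed simp
  then have strict: "W' \<subseteq> lp_strict p \<union> {0}"
    by blast
  have "seq.subspace W'"
    unfolding W'_def
    by (intro seq.subspace_inter subspace_lp subspace_common_kernel[OF \<Psi>(1)] \<open>p > 0\<close>)
  moreover have "closedin (lp_topology p) W'"
    unfolding W'_def using closedin_lp_kernels[OF \<open>p > 0\<close> \<Psi>(1)] .
  moreover have "W \<subseteq> W'"
    using W_lp copies0 unfolding W'_def \<Psi>(2) by force
  moreover have "T \<subseteq> W'"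
    using T(1) zero unfolding W'_def \<Psi>(2) by force
  ultimately show thesis
    using strict T by (intro that[of W' T])
qed

section \<open>Hamel dimensions\<close>

context vector_space
begin

lemma card_of_le_hamel_dim:
  assumes "subspace W" "T \<subseteq> W" "independent T"
  shows "|T| \<le>o hamel_dim scale W"
proof -
  obtain B where "T \<subseteq> B" "B \<subseteq> W" "independent B" "W \<subseteq> span B"
    using maximal_independent_subset_extend[OF assms(2,3)] .
  with assms(1) have "hamel_basis scale W B"
    unfolding hamel_basis_def by (metis span_minimal subset_antisym)
  with \<open>T \<subseteq> B\<close> show ?thesis
    using hamel_dim_eq card_of_mono1 ordIso_symmetric ordLeq_ordIso_trans by blast
qed

lemma hamel_dim_le_card_of:
  assumes "subspace W"
  shows "hamel_dim scale W \<le>o |W|"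
proof -
  obtain B where B: "hamel_basis scale W B"
    using hamel_basis_exists[OF assms] by blast
  then have "B \<subseteq> W"
    using span_superset unfolding hamel_basis_def by blast
  with B show ?thesis
    using hamel_dim_eq card_of_mono1 ordIso_ordLeq_trans by blast
qed

end

text \<open>There are at most continuum many scalar sequences, which bounds the dimension from
  above; \<open>T\<close> bounds it from below. The injection \<open>f\<close> covers real and
  complex scalars at once.\<close>

lemma hamel_dim_seq_continuum:
  fixes f :: "'k::field \<Rightarrow> real" and W :: "(nat \<Rightarrow> 'k) set"
  assumes "inj f" "seq.subspace W" "T \<subseteq> W" "\<not> seq.dependent T" "|UNIV :: real set| \<le>o |T|"
  shows "hamel_dim seq_scale W =o |UNIV :: real set|"
  unfolding ordIso_iff_ordLeq
proof
  have "|W| \<le>o |UNIV :: (nat \<Rightarrow> 'k) set|"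
    by (rule card_of_mono1) simp
  then have "|W| \<le>o |UNIV :: real set|"
    using card_of_seqs_le_real[OF \<open>inj f\<close>] by (rule ordLeq_transitive)
  with seq.hamel_dim_le_card_of[OF assms(2)] show "hamel_dim seq_scale W \<le>o |UNIV :: real set|"
    by (rule ordLeq_transitive)
  show "|UNIV :: real set| \<le>o hamel_dim seq_scale W"
    using assms(5) seq.card_of_le_hamel_dim[OF assms(2-4)] by (rule ordLeq_transitive)
qed

section \<open>Infinite-dimensional subspaces\<close>

definition unit_seq :: "nat \<Rightarrow> 'k::real_normed_field" where
  "unit_seq j = (if j = 0 then 1 else 0)"

lemma unit_seq_in_lp: "(unit_seq :: nat \<Rightarrow> 'k::real_normed_field) \<in> lp q"
proof -
  have "summable (\<lambda>j. norm (unit_seq j :: 'k) powr q)"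
    by (rule summable_finite[of "{0}"]) (auto simp: unit_seq_def)
  then show ?thesis
    by (simp add: lp_def)
qed

text \<open>A finitely supported sequence lies in every \<open>lp q\<close>, in particular for
  \<open>q = p / 2\<close>.\<close>

lemma unit_seq_notin_strict:
  assumes "p > 0"
  shows "unit_seq \<notin> lp_strict p \<union> {0 :: nat \<Rightarrow> 'k::real_normed_field}"
proof
  assume "unit_seq \<in> lp_strict p \<union> {0 :: nat \<Rightarrow> 'k}"
  moreover have "(unit_seq :: nat \<Rightarrow> 'k) 0 \<noteq> 0 0"
    by (simp add: unit_seq_def)
  ultimately have "(unit_seq :: nat \<Rightarrow> 'k) \<notin> lp (p / 2)"
    using assms by (fastforce simp: lp_strict_def)
  then show False
    using unit_seq_in_lp by blast
qed

lemma zero_notin_lp_strict: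
  assumes "p > 0"
  shows "0 \<notin> lp_strict p"
  using assms subspace_lp[of "p / 2", THEN seq.subspace_0] by (force simp: lp_strict_def)

lemma lp_strict_add_unit_seq:
  fixes y :: "nat \<Rightarrow> 'k::real_normed_field"
  assumes "p > 0" "y \<in> lp_strict p"
  shows "seq_scale c unit_seq + y \<in> lp_strict p"
proof -
  have iff: "seq_scale c unit_seq + y \<in> lp q \<longleftrightarrow> y \<in> lp q" if "q > 0" for q
  proof
    have e: "seq_scale c unit_seq \<in> lp q"
      using subspace_lp[OF that] unit_seq_in_lp by (rule seq.subspace_scale)
    show "y \<in> lp q" if "seq_scale c unit_seq + y \<in> lp q"
      using seq.subspace_diff[OF subspace_lp[OF \<open>q > 0\<close>] that e] by simp
    show "seq_scale c unit_seq + y \<in> lp q" if "y \<in> lp q"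
      using seq.subspace_add[OF subspace_lp[OF \<open>q > 0\<close>] e that] .
  qed
  with assms show ?thesis
    by (auto simp: lp_strict_def)
qed

text \<open>A combination of the \<open>u b\<close> is a multiple of \<open>unit_seq\<close> plus
  some \<open>y\<close> in the span of \<open>B\<close>. If \<open>y\<close> is nonzero, it is
  strict and remains so after adding the multiple; if \<open>y = 0\<close>, independence of
  \<open>B\<close> and \<open>s b \<noteq> 0\<close> kill all coefficients.\<close>

lemma perturbed_basis:
  fixes B :: "(nat \<Rightarrow> 'k::real_normed_field) set" and s :: "(nat \<Rightarrow> 'k) \<Rightarrow> 'k"
  assumes "p > 0" and ind: "\<not> seq.dependent B" and strict: "seq.span B \<subseteq> lp_strict p \<union> {0}"
    and s: "\<And>b. b \<in> B \<Longrightarrow> s b \<noteq> 0"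
  defines "u \<equiv> \<lambda>b. unit_seq + seq_scale (s b) b"
  shows "inj_on u B" "\<not> seq.dependent (u ` B)" "seq.span (u ` B) \<subseteq> lp_strict p \<union> {0}"
proof -
  \<comment> \<open>All three conclusions rest on this dichotomy, because zero is not
    strict.\<close>
  have comb: "(\<Sum>b\<in>S. seq_scale (r b) (u b)) \<in> lp_strict p \<or> (\<forall>b\<in>S. r b = 0)"
    if S: "finite S" "S \<subseteq> B" for S r
  proof -
    define y where "y = (\<Sum>b\<in>S. seq_scale (r b * s b) b)"
    have eq: "(\<Sum>b\<in>S. seq_scale (r b) (u b)) = seq_scale (\<Sum>b\<in>S. r b) unit_seq + y"
      by (simp add: u_def y_def seq.scale_right_distrib sum.distrib seq.scale_sum_left)
    have "y \<in> seq.span B"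
      unfolding y_def using S by (intro seq.span_sum seq.span_scale seq.span_base) auto
    then consider "y = 0" | "y \<in> lp_strict p"
      using strict by blast
    then show ?thesis
    proof cases
      case 1
      have "r b * s b = 0" if "b \<in> S" for b
        using seq.independentD[OF ind S, of "\<lambda>b. r b * s b" b] 1 that by (simp add: y_def)
      then show ?thesis
        using s S by auto
    next
      case 2
      then show ?thesis
        unfolding eq using lp_strict_add_unit_seq[OF \<open>p > 0\<close>] by blast
    qed
  qed
  show "inj_on u B"
  proof (rule inj_onI, rule ccontr)
    fix b c assume bc: "b \<in> B" "c \<in> B" "u b = u c" "b \<noteq> c"
    \<comment> \<open>A coincidence \<open>u b = u c\<close> would make the combination with
      coefficients 1 and -1 vanish.\<close>
    define r :: "(nat \<Rightarrow> 'k) \<Rightarrow> 'k" where "r d = (if d = b then 1 else - 1)" for d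
    have "(\<Sum>d\<in>{b, c}. seq_scale (r d) (u d)) = 0"
      using bc by (simp add: r_def)
    then show False
      using comb[of "{b, c}" r] bc zero_notin_lp_strict[OF \<open>p > 0\<close>] by (auto simp: r_def)
  qed
  have image: "\<forall>a\<in>S'. r a = 0"
    if S': "finite S'" "S' \<subseteq> u ` B" "(\<Sum>a\<in>S'. seq_scale (r a) a) \<notin> lp_strict p" for S' r
  proof -
    obtain S where S: "S \<subseteq> B" "inj_on u S" "S' = u ` S"
      using S'(2) unfolding subset_image_inj by blast
    with S' have "finite S"
      by (simp add: finite_image_iff)
    with S S' show ?thesis
      using comb[of S "\<lambda>b. r (u b)"] by (simp add: sum.reindex)
  qed
  show "\<not> seq.dependent (u ` B)"
    unfolding seq.independent_explicit_finite_subsets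
    using image zero_notin_lp_strict[OF \<open>p > 0\<close>] by metis
  show "seq.span (u ` B) \<subseteq> lp_strict p \<union> {0}"
  proof
    fix z assume "z \<in> seq.span (u ` B)"
    then obtain S' r where S': "finite S'" "S' \<subseteq> u ` B" "z = (\<Sum>a\<in>S'. seq_scale (r a) a)"
      unfolding seq.span_explicit by blast
    then show "z \<in> lp_strict p \<union> {0}"
      using image[of S' r] by (cases "z \<in> lp_strict p") auto
  qed
qed

text \<open>The perturbed vectors of a countable part of \<open>B\<close> converge to
  \<open>unit_seq\<close>, so every closed set containing their span contains this non-strict
  sequence.\<close>

lemma infinite_dim_no_extension:
  fixes B :: "(nat \<Rightarrow> 'k::real_normed_field) set"
  assumes "p > 0" and ind: "\<not> seq.dependent B" and strict: "seq.span B \<subseteq> lp_strict p \<union> {0}"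
    and "infinite B"
  obtains C :: "(nat \<Rightarrow> 'k) set" where "|C| =o |B|" "\<not> seq.dependent C" "seq.span C \<subseteq> lp_strict p \<union> {0}"
    "\<forall>W. closedin (lp_topology p) W \<and> seq.span C \<subseteq> W \<longrightarrow> \<not> W \<subseteq> lp_strict p \<union> {0}"
proof -
  obtain g :: "nat \<Rightarrow> nat \<Rightarrow> 'k" where g: "inj g" "range g \<subseteq> B"
    using infinite_countable_subset[OF \<open>infinite B\<close>] by blast
  \<comment> \<open>For \<open>b = g n\<close> this gives the vector \<open>t b\<close> times
    \<open>b\<close> norm at most \<open>1 / (n + 1)\<close>; the summand 1 keeps the denominator
    positive. Outside the range of \<open>g\<close> the value of \<open>inv g b\<close> is
    arbitrary, and only \<open>t b > 0\<close> matters there.\<close>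
  define t where "t b = 1 / (real (Suc (inv g b)) * (1 + lp_norm p b))" for b :: "nat \<Rightarrow> 'k"
  define u where "u b = unit_seq + seq_scale (of_real (t b)) b" for b :: "nat \<Rightarrow> 'k"
  have t: "t b > 0" for b
    using lp_norm_nonneg[of p b] by (auto simp: t_def intro!: divide_pos_pos mult_pos_pos)
  have "of_real (t b) \<noteq> (0 :: 'k)" for b
    using t[of b] by simp
  note u = perturbed_basis[OF \<open>p > 0\<close> ind strict, of "\<lambda>b. of_real (t b)", OF this, folded u_def]
  have "\<forall>W. closedin (lp_topology p) W \<and> seq.span (u ` B) \<subseteq> W \<longrightarrow> \<not> W \<subseteq> lp_strict p \<union> {0}"
  proof (intro allI impI notI, elim conjE)
    fix W assume W: "closedin (lp_topology p) W" "seq.span (u ` B) \<subseteq> W"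
      and "W \<subseteq> lp_strict p \<union> {0}"
    then have "unit_seq \<in> lp p - W"
      using unit_seq_notin_strict[OF \<open>p > 0\<close>] unit_seq_in_lp by blast
    moreover have "openin (lp_topology p) (lp p - W)"
      using W(1) by (simp add: closedin_def)
    ultimately obtain e where e: "e > 0" "\<And>y. y \<in> lp p \<Longrightarrow> lp_norm p (y - unit_seq) < e \<Longrightarrow> y \<notin> W"
      unfolding openin_lp_topology by blast
    obtain n where n: "1 / real (Suc n) < e"
      using nat_approx_posE[OF e(1)] by blast
    define b where "b = g n"
    have "b \<in> B"
      using g by (auto simp: b_def)
    then have "b \<in> lp_strict p \<union> {0}"
      using strict seq.span_base by blast
    then have b_lp: "b \<in> lp p"
      using subspace_lp[OF \<open>p > 0\<close>, THEN seq.subspace_0] by (auto simp: lp_strict_def)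
    have "u b \<in> W"
      using \<open>b \<in> B\<close> W(2) seq.span_base by blast
    have "lp_norm p (u b - unit_seq) = t b * lp_norm p b"
      using lp_norm_scale[OF \<open>p > 0\<close> b_lp] t[of b] by (simp add: u_def)
    also have "\<dots> = 1 / real (Suc n) * (lp_norm p b / (1 + lp_norm p b))"
      using g by (simp add: t_def b_def)
    also have "\<dots> \<le> 1 / real (Suc n) * 1"
      using lp_norm_nonneg[of p b] by (intro mult_left_mono) auto
    also have "\<dots> < e"
      using n by simp
    finally have "lp_norm p (u b - unit_seq) < e" .
    moreover have "u b \<in> lp p"
      using \<open>u b \<in> W\<close> closedin_subset[OF W(1)] by auto
    ultimately show False
      using e(2) \<open>u b \<in> W\<close> by blast
  qed
  moreover have "|u ` B| =o |B|"
    using u(1) by (intro ordIso_symmetric[OF card_of_ordIsoI[of u]] inj_on_imp_bij_betw)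
  ultimately show thesis
    using u by (intro that[of "u ` B"])
qed

section \<open>The characterization of spaceability\<close>

lemma finite_if_ordLess_nat:
  assumes "|B| <o |UNIV :: nat set|"
  shows "finite B"
proof (rule ccontr)
  assume "infinite B"
  then have "|UNIV :: nat set| \<le>o |B|"
    by (simp add: infinite_iff_card_of_nat)
  then show False
    using not_ordLess_ordLeq[OF assms] by blast
qed

lemma spaceable_lp_strict_iff:
  fixes f :: "'k::real_normed_field \<Rightarrow> real" and \<alpha> :: "'c rel"
  assumes "inj f" "p > 0" and \<alpha>: "Card_order \<alpha>" "\<alpha> <o |UNIV :: real set|"
  shows "spaceable seq_scale (lp_topology p) \<alpha> ( |UNIV :: real set| )
      (lp_strict p :: (nat \<Rightarrow> 'k) set) \<longleftrightarrow> \<alpha> <o |UNIV :: nat set|"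
proof
  assume sp: "spaceable seq_scale (lp_topology p) \<alpha> ( |UNIV :: real set| )
      (lp_strict p :: (nat \<Rightarrow> 'k) set)"
  show "\<alpha> <o |UNIV :: nat set|"
  proof (rule ccontr)
    assume "\<not> \<alpha> <o |UNIV :: nat set|"
    moreover have "Well_order \<alpha>"
      using \<alpha>(2) by (simp add: ordLess_def)
    ultimately have nat_le: "|UNIV :: nat set| \<le>o \<alpha>"
      using not_ordLess_iff_ordLeq[OF card_of_Well_order] by blast
    \<comment> \<open>Lineability provides a strict space of dimension \<alpha>; perturbing its
      basis yields another one of the same dimension that has no closed strict extension.\<close>
    obtain U where U: "seq.subspace U" "U \<subseteq> lp_strict p \<union> {0 :: nat \<Rightarrow> 'k}"
      "hamel_dim seq_scale U =o \<alpha>"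
      using sp by (auto simp: spaceable_def lineable_def)
    obtain B where B: "hamel_basis seq_scale U B"
      using seq.hamel_basis_exists[OF U(1)] by blast
    then have B_\<alpha>: "|B| =o \<alpha>"
      using seq.hamel_dim_eq U(3) ordIso_symmetric ordIso_transitive by blast
    with nat_le have "infinite B"
      unfolding infinite_iff_card_of_nat using ordIso_symmetric ordLeq_ordIso_trans by blast
    have ind: "\<not> seq.dependent B" "seq.span B \<subseteq> lp_strict p \<union> {0}"
      using B U(2) by (simp_all add: hamel_basis_def)
    obtain C :: "(nat \<Rightarrow> 'k) set" where C: "|C| =o |B|" "\<not> seq.dependent C"
      "seq.span C \<subseteq> lp_strict p \<union> {0}"
      "\<forall>W. closedin (lp_topology p) W \<and> seq.span C \<subseteq> W \<longrightarrow> \<not> W \<subseteq> lp_strict p \<union> {0}"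
      using infinite_dim_no_extension[OF \<open>p > 0\<close> ind \<open>infinite B\<close>] .
    have "hamel_dim seq_scale (seq.span C) =o |C|"
      using C(2) by (intro seq.hamel_dim_eq) (simp add: hamel_basis_def)
    then have "hamel_dim seq_scale (seq.span C) =o \<alpha>"
      using C(1) B_\<alpha> ordIso_transitive by blast
    then obtain W where W: "closedin (lp_topology p) W" "seq.span C \<subseteq> W" "W \<subseteq> lp_strict p \<union> {0}"
      using sp C(3) seq.subspace_span[of C] unfolding spaceable_def by meson
    show False
      by (rule notE[OF C(4)[rule_format, OF conjI[OF W(1,2)]] W(3)])
  qed
next
  assume fin: "\<alpha> <o |UNIV :: nat set|"
  have ext: "\<exists>W'. seq.subspace W' \<and> closedin (lp_topology p) W' \<and>
      hamel_dim seq_scale W' =o |UNIV :: real set| \<and> W \<subseteq> W' \<and> W' \<subseteq> lp_strict p \<union> {0}"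
    if W: "seq.subspace W" "W \<subseteq> lp_strict p \<union> {0}" "hamel_dim seq_scale W =o \<alpha>"
    for W :: "(nat \<Rightarrow> 'k) set"
  proof -
    obtain B where B: "hamel_basis seq_scale W B"
      using seq.hamel_basis_exists[OF W(1)] by blast
    then have "|B| =o \<alpha>"
      using seq.hamel_dim_eq W(3) ordIso_symmetric ordIso_transitive by blast
    then have "finite B"
      using finite_if_ordLess_nat ordIso_ordLess_trans fin by blast
    have span: "seq.span B = W"
      using B by (simp add: hamel_basis_def)
    obtain W' T where W': "seq.subspace W'" "closedin (lp_topology p) W'" "W \<subseteq> W'"
      "W' \<subseteq> lp_strict p \<union> {0}" and T: "T \<subseteq> W'" "\<not> seq.dependent T" "|UNIV :: real set| \<le>o |T|"
      using finite_dim_extension[OF \<open>p > 0\<close> \<open>finite B\<close> span W(2)] .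
    show ?thesis
      using W' hamel_dim_seq_continuum[OF \<open>inj f\<close> W'(1) T] by (intro exI[of _ W'] conjI)
  qed
  \<comment> \<open>Extending the zero space gives a strict space with a continuum of independent
    vectors. It yields both the lower bound for the dimension of \<open>lp p\<close> and
    lineability.\<close>
  obtain V T where V: "seq.subspace V" "V \<subseteq> lp_strict p \<union> {0 :: nat \<Rightarrow> 'k}"
    and T: "T \<subseteq> V" "\<not> seq.dependent T" "|UNIV :: real set| \<le>o |T|"
    by (rule finite_dim_extension[OF \<open>p > 0\<close> finite.emptyI seq.span_empty Un_upper2])
  have lp: "seq.subspace (lp p :: (nat \<Rightarrow> 'k) set)"
    using \<open>p > 0\<close> by (rule subspace_lp)
  have "V \<subseteq> lp p"
    using V(2) seq.subspace_0[OF lp] by (auto simp: lp_strict_def)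
  with T have "|T| \<le>o hamel_dim seq_scale (lp p :: (nat \<Rightarrow> 'k) set)"
    by (intro seq.card_of_le_hamel_dim lp) auto
  with T(3) have dim: "|UNIV :: real set| \<le>o hamel_dim seq_scale (lp p :: (nat \<Rightarrow> 'k) set)"
    by (rule ordLeq_transitive)
  \<comment> \<open>\<open>Field \<alpha>\<close> is a set of cardinality \<alpha>; a subset of
    \<open>T\<close> of that size spans a strict space of dimension \<alpha>.\<close>
  have "|Field \<alpha>| \<le>o |T|"
    using card_of_Field_ordIso[OF \<alpha>(1)] \<alpha>(2) T(3)
    by (meson ordIso_ordLess_trans ordLess_imp_ordLeq ordLeq_transitive)
  then obtain S where S: "S \<subseteq> T" "|Field \<alpha>| =o |S|"
    using internalize_card_of_ordLeq2[of "Field \<alpha>" T] by blast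
  have "\<not> seq.dependent S"
    using seq.independent_mono[OF T(2) S(1)] .
  then have "hamel_dim seq_scale (seq.span S) =o |S|"
    by (intro seq.hamel_dim_eq) (simp add: hamel_basis_def)
  then have "hamel_dim seq_scale (seq.span S) =o \<alpha>"
    using S(2) card_of_Field_ordIso[OF \<alpha>(1)] by (meson ordIso_symmetric ordIso_transitive)
  moreover have "seq.span S \<subseteq> lp_strict p \<union> {0}"
    using seq.span_minimal[OF _ V(1), of S] S T V(2) by blast
  ultimately have "lineable seq_scale \<alpha> (lp_strict p :: (nat \<Rightarrow> 'k) set)"
    unfolding lineable_def using seq.subspace_span by blast
  then show "spaceable seq_scale (lp_topology p) \<alpha> ( |UNIV :: real set| )
      (lp_strict p :: (nat \<Rightarrow> 'k) set)"
    unfolding spaceable_def topspace_lp_topology using \<alpha>(2) dim ext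
    by (auto simp: lp_strict_def)
qed

theorem theorem2p2:
  fixes p :: real and \<alpha> :: "'c rel"
  assumes "p > 0"
    and "Card_order \<alpha>" and "\<alpha> <o |UNIV :: real set|"
  shows "(spaceable seq_scale (lp_topology p) \<alpha> ( |UNIV :: real set| ) (lp_strict p :: (nat \<Rightarrow> real) set)
            \<longleftrightarrow> \<alpha> <o |UNIV :: nat set| ) \<and>
         (spaceable seq_scale (lp_topology p) \<alpha> ( |UNIV :: real set| ) (lp_strict p :: (nat \<Rightarrow> complex) set)
            \<longleftrightarrow> \<alpha> <o |UNIV :: nat set| )"
proof -
  obtain f :: "complex \<Rightarrow> real" where "inj f"
    using ex_inj_complex_real by blast
  moreover have "inj (\<lambda>x :: real. x)"
    by simp
  ultimately show ?thesis
    using assms by (intro conjI spaceable_lp_strict_iff)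
qed

end
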